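(* Let $\theta>0$ and let $\ell\ge 1$ be an integer. Let $X_1,X_2,\ldots$ be i.i.d. random variables with the same distribution as $\widehat Q_1^{\ell,\theta}$, that is, $$\mathbb P(X_j=n)=\widehat q^{\,\theta}(\ell,n)\qquad\text{for } n\ge \ell,$$ and let $(R_j,\ j\ge0)$ be the weak ascending record process of $(X_j,\ j\ge1)$. Then there is the equality in joint distribution $$(\widehat Q_j^{\ell,\theta},\ j\ge0)\stackrel{(d)}{=}(R_j,\ j\ge 0).$$
   Context: For real $x$ and integer $j\ge0$, $(x)_j:=x(x+1)\cdots(x+j-1)=\Gamma(x+j)/\Gamma(x)$, with $(x)_0=1$. The Markov chain $(\widehat Q_j^{\ell,\theta},\ j\ge0)$ has state space $\{1,2,\ldots\}$, initial value $\widehat Q_0^{\ell,\theta}=\ell$, and stationary transition probabilities $$\widehat q^{\,\theta}(m,n):=\frac{(m)_{n-m}\,\theta}{(\theta+m)_{n-m+1}}\quad\text{for } m\le n,$$ and $\widehat q^{\,\theta}(m,n)=0$ for $n<m$. (Equivalently, $\widehat q^{\,\theta}(m,n)=\binom{n-1}{m-1}\mathbb E[W^{n-m}(1-W)^m]$ for $m\le n$, where $W$ has the beta$(1,\theta)$ distribution, with density $\theta(1-x)^{\theta-1}$ on $[0,1]$.) The weak ascending record process $(R_j,\ j\ge0)$ of a sequence $(X_j,\ j\ge1)$ of random variables with values in $\{\ell,\ell+1,\ldots\}$ is defined by $R_0:=\ell$ and $R_j:=X_{L_j}$ for $j\ge1$, where $L_1:=1$ and $L_{j+1}:=\min\{i>L_j: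 X_i\ge X_{L_j}\}$ for $j\ge1$. *)

theory Defs
  imports "HOL-Probability.Probability"
begin

definition qhat :: "real \<Rightarrow> nat \<Rightarrow> nat \<Rightarrow> real" where
  "qhat \<theta> m n =
     (if m \<le> n
      then pochhammer (real m) (n - m) * \<theta> / pochhammer (\<theta> + real m) (n - m + 1)
      else 0)"

text \<open>
  Time-homogeneous Markov chains in discrete time on a countable state space, in elementary form:
  the conditional law of the next state is prescribed given every history of positive probability.
  Being measurable into \<open>count_space S\<close> includes taking values in \<open>S\<close>.
\<close>

definition markov_chain ::
  "'a measure \<Rightarrow> 's set \<Rightarrow> 's \<Rightarrow> ('s \<Rightarrow> 's \<Rightarrow> real) \<Rightarrow> (nat \<Rightarrow> 'a \<Rightarrow> 's) \<Rightarrow> bool" where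
  "markov_chain M S s0 p Y \<longleftrightarrow>
     prob_space M \<and> countable S \<and>
     (\<forall>j. Y j \<in> M \<rightarrow>\<^sub>M count_space S) \<and>
     (AE \<omega> in M. Y 0 \<omega> = s0) \<and>
     (\<forall>j s. \<forall>n\<in>S. \<P>(\<omega> in M. \<forall>i\<le>j. Y i \<omega> = s i) > 0 \<longrightarrow>
        \<P>(\<omega> in M. Y (Suc j) \<omega> = n \<bar> \<forall>i\<le>j. Y i \<omega> = s i) = p (s j) n)"

text \<open>
  Sequences \<open>x\<close> are indexed by \<open>{1..}\<close>; neither \<open>x 0\<close> nor \<open>weak_record_index x 0\<close> plays any role.
  If there is no further weak record, which has probability zero for the sequences of interest,
  the index is left unchanged; so the index is always at least 1 for \<open>j \<ge> 1\<close>.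
\<close>

fun weak_record_index :: "(nat \<Rightarrow> nat) \<Rightarrow> nat \<Rightarrow> nat" where
  "weak_record_index x 0 = 0"
| "weak_record_index x (Suc 0) = 1"
| "weak_record_index x (Suc (Suc j)) =
     (let k = weak_record_index x (Suc j) in
      if \<exists>i>k. x i \<ge> x k then LEAST i. i > k \<and> x i \<ge> x k else k)"

definition weak_record :: "nat \<Rightarrow> (nat \<Rightarrow> nat) \<Rightarrow> nat \<Rightarrow> nat" where
  "weak_record l x j = (if j = 0 then l else x (weak_record_index x j))"

end

theory Submission imports Defs
begin

text \<open>
  The idea: the kernel started at \<open>m\<close> is the kernel started at \<open>l\<close> conditioned to be at
  least \<open>m\<close>. Indeed, splitting both Pochhammer symbols at \<open>m\<close> gives
  \<open>qhat \<theta> l n = T m * qhat \<theta> m n\<close> for \<open>l \<le> m \<le> n\<close>, where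
  \<open>T m = (l)\<^bsub>m-l\<^esub> / (\<theta>+l)\<^bsub>m-l\<^esub>\<close> (lemma \<open>qhat_eq_tail_times_qhat\<close>), and a telescoping sum
  identifies \<open>T m\<close> as the probability that a sample term is at least \<open>m\<close>. On the other hand,
  the successor of a weak record with value \<open>m\<close> is the first later term that is at least
  \<open>m\<close>, so its law is that of a sample term conditioned to be at least \<open>m\<close>. Hence records and
  chain have the same transition probabilities.

  To make this rigorous, the event that the first \<open>j\<close> records are \<open>s 1, \<dots>, s j\<close> is split
  according to the time \<open>k\<close> of the \<open>j\<close>-th one (\<open>record_path\<close>); each part is decided by the
  first \<open>k\<close> terms and therefore independent of the later ones. If \<open>h j k\<close> is its probability,
  then \<open>h (j+1) (n+1)\<close> is \<open>qhat \<theta> l (s (j+1))\<close> times the convolution of \<open>h j\<close> with the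
  powers of \<open>1 - T (s j)\<close>, a power counting the terms below the current record. Summing the
  Cauchy product over \<open>n\<close> contributes the geometric sum \<open>1 / T (s j)\<close>, which turns
  \<open>qhat \<theta> l (s (j+1))\<close> into \<open>qhat \<theta> (s j) (s (j+1))\<close> (lemma \<open>prob_record_path_sums\<close>).
  Almost surely every level is exceeded again and again, so the \<open>j\<close>-th record exists and the
  sum over \<open>k\<close> is the full probability. The chain has the same product as its
  finite-dimensional distribution by the Markov property, and these distributions determine
  the law of a sequence.
\<close>

section \<open>The transition kernel and its tails\<close>

text \<open>For \<open>m \<ge> l\<close>, the probability that a draw from \<open>qhat \<theta> l\<close> is at least \<open>m\<close>.\<close>

definition qhat_tail :: "real \<Rightarrow> nat \<Rightarrow> nat \<Rightarrow> real" where
  "qhat_tail \<theta> l m = pochhammer (real l) (m - l) / pochhammer (\<theta> + real l) (m - l)"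

lemma qhat_tail_pos: "\<theta> > 0 \<Longrightarrow> l \<ge> 1 \<Longrightarrow> qhat_tail \<theta> l m > 0"
  by (simp add: qhat_tail_def pochhammer_pos)

text \<open>
  Conditioning \<open>qhat \<theta> l\<close> to be at least \<open>m\<close> gives \<open>qhat \<theta> m\<close>, because both Pochhammer
  symbols factor at \<open>m\<close>. This self-similarity is what makes the chain a record process.
\<close>

lemma qhat_eq_tail_times_qhat:
  assumes "l \<le> m" "m \<le> n"
  shows "qhat \<theta> l n = qhat_tail \<theta> l m * qhat \<theta> m n"
proof -
  have n: "n - l = (m - l) + (n - m)" "n - l + 1 = (m - l) + (n - m + 1)"
    using assms by auto
  have "pochhammer (real l) (n - l) = pochhammer (real l) (m - l) * pochhammer (real m) (n - m)"
    unfolding n(1) pochhammer_product' using assms by (simp add: of_nat_diff)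
  moreover have "pochhammer (\<theta> + real l) (n - l + 1)
      = pochhammer (\<theta> + real l) (m - l) * pochhammer (\<theta> + real m) (n - m + 1)"
    unfolding n(2) pochhammer_product' using assms by (simp add: of_nat_diff)
  ultimately show ?thesis
    using assms by (simp add: qhat_def qhat_tail_def)
qed

text \<open>
  By the factorisation at \<open>m\<close>, both terms are multiples of \<open>qhat_tail \<theta> l m\<close>, with the factors
  \<open>\<theta> / (\<theta> + m)\<close> and \<open>m / (\<theta> + m)\<close>. Summing this identity telescopes.
\<close>

lemma qhat_plus_qhat_tail_Suc:
  assumes "\<theta> > 0" "l \<le> m"
  shows "qhat \<theta> l m + qhat_tail \<theta> l (Suc m) = qhat_tail \<theta> l m"
proof -
  have pos: "\<theta> + real m > 0" using assms by simp
  have "qhat_tail \<theta> l (Suc m) = qhat_tail \<theta> l m * (real m / (\<theta> + real m))"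
    using assms by (simp add: qhat_tail_def Suc_diff_le pochhammer_rec' of_nat_diff mult_ac)
  moreover have "qhat \<theta> l m = qhat_tail \<theta> l m * (\<theta> / (\<theta> + real m))"
    using qhat_eq_tail_times_qhat[OF assms(2) order.refl] by (simp add: qhat_def)
  moreover have "\<theta> / (\<theta> + real m) + real m / (\<theta> + real m) = 1"
    using pos by (simp flip: add_divide_distrib)
  ultimately show ?thesis by (metis distrib_left mult.right_neutral)
qed

lemma sum_qhat_below:
  assumes "\<theta> > 0" "l \<le> m"
  shows "(\<Sum>n=l..<m. qhat \<theta> l n) = 1 - qhat_tail \<theta> l m"
  using assms(2)
proof (induction rule: dec_induct)
  case base
  then show ?case by (simp add: qhat_tail_def)
next
  case (step m)
  then show ?case using qhat_plus_qhat_tail_Suc[OF assms(1) step.hyps(1)] by simp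
qed

lemma qhat_eq_0: "n < m \<Longrightarrow> qhat \<theta> m n = 0"
  by (simp add: qhat_def)

text \<open>The probability that the chain started at \<open>l\<close> follows \<open>s\<close> up to time \<open>j\<close>.\<close>

definition qhat_path :: "real \<Rightarrow> nat \<Rightarrow> (nat \<Rightarrow> nat) \<Rightarrow> nat \<Rightarrow> real" where
  "qhat_path \<theta> l s j = of_bool (s 0 = l) * (\<Prod>i<j. qhat \<theta> (s i) (s (Suc i)))"

lemma qhat_path_0: "qhat_path \<theta> l s 0 = of_bool (s 0 = l)"
  and qhat_path_Suc: "qhat_path \<theta> l s (Suc j) = qhat_path \<theta> l s j * qhat \<theta> (s j) (s (Suc j))"
  by (simp_all add: qhat_path_def)

section \<open>Weak records of a deterministic sequence\<close>

text \<open>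
  The initial value \<open>l\<close> is treated as a record at the fictitious time \<open>0\<close>. When all terms are
  at least \<open>l\<close>, the first term is then the next weak record, so the first step needs no separate
  rule. Existence of the next record is demanded, in contrast to \<open>weak_record_index\<close> with its
  fallback value; this makes the event depend on the terms up to \<open>k\<close> only. The condition
  \<open>s j \<le> s (Suc j)\<close> excludes paths that no record sequence can follow.
\<close>

fun record_path :: "nat \<Rightarrow> (nat \<Rightarrow> nat) \<Rightarrow> nat \<Rightarrow> nat \<Rightarrow> (nat \<Rightarrow> nat) \<Rightarrow> bool" where
  "record_path l s 0 k x \<longleftrightarrow> k = 0 \<and> s 0 = l"
| "record_path l s (Suc j) k x \<longleftrightarrow>
     (\<exists>i<k. record_path l s j i x \<and> (\<forall>h. i < h \<and> h < k \<longrightarrow> x h < s j) \<and>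
       s j \<le> s (Suc j) \<and> x k = s (Suc j))"

lemma record_path_cong:
  assumes "\<And>i. 1 \<le> i \<Longrightarrow> i \<le> k \<Longrightarrow> x i = y i"
  shows "record_path l s j k x \<longleftrightarrow> record_path l s j k y"
  using assms
proof (induction j arbitrary: k)
  case (Suc j)
  have "(record_path l s j i x \<and> (\<forall>h. i < h \<and> h < k \<longrightarrow> x h < s j) \<and> s j \<le> s (Suc j) \<and> x k = s (Suc j))
    \<longleftrightarrow> (record_path l s j i y \<and> (\<forall>h. i < h \<and> h < k \<longrightarrow> y h < s j) \<and> s j \<le> s (Suc j) \<and> y k = s (Suc j))"
    if "i < k" for i
    using Suc.IH[of i] Suc.prems that by auto
  then show ?case by auto
qed simp

lemma record_path_ge: "record_path l s j k x \<Longrightarrow> l \<le> s j"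
proof (induction j arbitrary: k)
  case (Suc j)
  then obtain i where "record_path l s j i x" "s j \<le> s (Suc j)" by auto
  then show ?case using Suc.IH by (meson order.trans)
qed simp

text \<open>
  Two different candidate times after the same predecessor cannot both be the first return to the
  level \<open>s j\<close>. Hence the events for different \<open>k\<close> are disjoint.
\<close>

lemma record_path_unique:
  "record_path l s j k x \<Longrightarrow> record_path l s j k' x \<Longrightarrow> k = k'"
proof (induction j arbitrary: k k')
  case (Suc j)
  from Suc.prems(1) obtain i where i: "i < k" "record_path l s j i x"
    "\<forall>h. i < h \<and> h < k \<longrightarrow> x h < s j" "s j \<le> s (Suc j)" "x k = s (Suc j)" by auto
  from Suc.prems(2) obtain i' where i': "i' < k'" "record_path l s j i' x"
    "\<forall>h. i' < h \<and> h < k' \<longrightarrow> x h < s j" "s j \<le> s (Suc j)" "x k' = s (Suc j)" by auto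
  have "i = i'" using Suc.IH i(2) i'(2) .
  then have "\<not> k < k'" "\<not> k' < k"
    using i i' by (metis not_less)+
  then show ?case by simp
qed simp

lemma weak_record_index_Suc:
  assumes "\<And>i. i \<ge> 1 \<Longrightarrow> l \<le> x i" "\<And>k m. \<exists>i>k. m \<le> x i"
  shows "weak_record_index x (Suc j)
    = (LEAST i. weak_record_index x j < i \<and> weak_record l x j \<le> x i)"
proof (cases j)
  case 0
  have "(LEAST i. 0 < i \<and> l \<le> x i) = 1"
    by (rule Least_equality) (use assms(1) in auto)
  then show ?thesis by (simp add: 0 weak_record_def)
next
  case (Suc j')
  then show ?thesis using assms(2) by (simp add: weak_record_def Let_def)
qed

text \<open>
  If every level is exceeded infinitely often, the fallback in \<open>weak_record_index\<close> is never used,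
  and the two descriptions of the records agree.
\<close>

lemma record_path_iff:
  assumes "\<And>i. i \<ge> 1 \<Longrightarrow> l \<le> x i" "\<And>k m. \<exists>i>k. m \<le> x i"
  shows "record_path l s j k x
    \<longleftrightarrow> k = weak_record_index x j \<and> (\<forall>i\<le>j. weak_record l x i = s i)"
proof (induction j arbitrary: k)
  case 0
  then show ?case by (auto simp: weak_record_def)
next
  case (Suc j)
  let ?i = "weak_record_index x j" and ?k = "weak_record_index x (Suc j)"
  let ?r = "weak_record l x j"
  have k_eq: "?k = (LEAST i. ?i < i \<and> ?r \<le> x i)"
    by (rule weak_record_index_Suc) (use assms in auto)
  have k: "?i < ?k \<and> ?r \<le> x ?k"
    unfolding k_eq by (rule LeastI_ex[where P = "\<lambda>i. ?i < i \<and> ?r \<le> x i"]) (rule assms(2))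
  have below: "x h < ?r" if "?i < h" "h < ?k" for h
    using not_less_Least[of h "\<lambda>i. ?i < i \<and> ?r \<le> x i"] that
    unfolding k_eq[symmetric] by auto
  have rec_Suc: "weak_record l x (Suc j) = x ?k" by (simp add: weak_record_def)
  have all: "(\<forall>i\<le>Suc j. weak_record l x i = s i)
      \<longleftrightarrow> (\<forall>i\<le>j. weak_record l x i = s i) \<and> x ?k = s (Suc j)"
    by (auto simp: le_Suc_eq rec_Suc)
  show ?case
  proof
    assume "record_path l s (Suc j) k x"
    then have *: "\<forall>i\<le>j. weak_record l x i = s i" "?i < k"
      "\<forall>h. ?i < h \<and> h < k \<longrightarrow> x h < s j" "s j \<le> s (Suc j)" "x k = s (Suc j)"
      using Suc.IH by auto
    then have "\<not> ?k < k" "\<not> k < ?k" using k below by (metis not_less order.refl)+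
    then show "k = ?k \<and> (\<forall>i\<le>Suc j. weak_record l x i = s i)"
      unfolding all using * by auto
  next
    assume *: "k = ?k \<and> (\<forall>i\<le>Suc j. weak_record l x i = s i)"
    then have "record_path l s j ?i x" "x ?k = s (Suc j)" "?r = s j"
      using Suc.IH unfolding all by auto
    then show "record_path l s (Suc j) k x"
      using k below * by (auto intro!: exI[of _ ?i])
  qed
qed

text \<open>
  Replacing the term at index \<open>0\<close> by the first one does not change the records. This yields
  measurability of the records when only the terms from index \<open>1\<close> on are random variables.
\<close>

lemma weak_record_max_1:
  "weak_record l (\<lambda>i. x (max 1 i)) j = weak_record l x j"
proof -
  have "weak_record_index (\<lambda>i. x (max 1 i)) j = weak_record_index x j
      \<and> (j \<ge> 1 \<longrightarrow> weak_record_index x j \<ge> 1)"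
  proof (induction x j rule: weak_record_index.induct)
    case (3 x j)
    let ?k = "weak_record_index x (Suc j)"
    have k: "weak_record_index (\<lambda>i. x (max 1 i)) (Suc j) = ?k" "1 \<le> ?k"
      using 3 by auto
    have "(?k < i \<and> x (max 1 ?k) \<le> x (max 1 i)) \<longleftrightarrow> (?k < i \<and> x ?k \<le> x i)" for i
      using k(2) by (auto simp: max_def)
    moreover have "1 \<le> (LEAST i. ?k < i \<and> x ?k \<le> x i)" if "\<exists>i. ?k < i \<and> x ?k \<le> x i"
      using LeastI_ex[OF that] by linarith
    ultimately show ?case using k by (auto simp: Let_def)
  qed auto
  then show ?thesis by (auto simp: weak_record_def max_def)
qed

section \<open>The past and the next term of an independent sequence\<close>

lemma measurable_count_space_UNIV:
  assumes "f \<in> M \<rightarrow>\<^sub>M count_space S"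
  shows "f \<in> M \<rightarrow>\<^sub>M count_space UNIV"
proof -
  have "(\<lambda>x. x) \<in> count_space S \<rightarrow>\<^sub>M count_space UNIV" by simp
  from measurable_compose[OF assms this] show ?thesis .
qed

lemma PiM_count_space_finite_power:
  assumes "finite J" "countable S"
  shows "PiM J (\<lambda>_. count_space S) = count_space (J \<rightarrow>\<^sub>E S)"
  using assms by (rule count_space_PiM_finite)

context prob_space
begin

text \<open>
  The values of the first \<open>k\<close> terms form a countable discrete space, so every property that they
  decide is an event, whatever its logical form.
\<close>

lemma past_event_measurable:
  fixes k :: nat
  assumes X: "\<And>i. i \<ge> 1 \<Longrightarrow> X i \<in> M \<rightarrow>\<^sub>M count_space S" and S: "countable S"
    and \<Phi>: "\<And>x y. (\<And>i. 1 \<le> i \<Longrightarrow> i \<le> k \<Longrightarrow> x i = y i) \<Longrightarrow> \<Phi> x \<longleftrightarrow> \<Phi> y"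
  shows "{\<omega> \<in> space M. \<Phi> (\<lambda>i. X i \<omega>)} \<in> events"
proof -
  let ?past = "\<lambda>\<omega>. restrict (\<lambda>i. X i \<omega>) {1..k}"
  have "?past \<in> M \<rightarrow>\<^sub>M PiM {1..k} (\<lambda>_. count_space S)"
    using X by (intro measurable_restrict) auto
  then have "?past \<in> M \<rightarrow>\<^sub>M count_space ({1..k} \<rightarrow>\<^sub>E S)"
    unfolding PiM_count_space_finite_power[OF finite_atLeastAtMost S] .
  then have "?past -` {x \<in> {1..k} \<rightarrow>\<^sub>E S. \<Phi> x} \<inter> space M \<in> events"
    by (rule measurable_sets) auto
  moreover have "?past -` {x \<in> {1..k} \<rightarrow>\<^sub>E S. \<Phi> x} \<inter> space M = {\<omega> \<in> space M. \<Phi> (\<lambda>i. X i \<omega>)}"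
  proof -
    have "?past \<omega> \<in> {1..k} \<rightarrow>\<^sub>E S" if "\<omega> \<in> space M" for \<omega>
      using measurable_space[OF X that] by auto
    moreover have "\<Phi> (?past \<omega>) \<longleftrightarrow> \<Phi> (\<lambda>i. X i \<omega>)" for \<omega> by (rule \<Phi>) simp
    ultimately show ?thesis by auto
  qed
  ultimately show ?thesis by simp
qed

lemma prob_past_and_next:
  fixes k :: nat
  assumes ind: "indep_vars (\<lambda>_. count_space S) X {1..}" and S: "countable S"
    and \<Phi>: "\<And>x y. (\<And>i. 1 \<le> i \<Longrightarrow> i \<le> k \<Longrightarrow> x i = y i) \<Longrightarrow> \<Phi> x \<longleftrightarrow> \<Phi> y"
  shows "\<P>(\<omega> in M. \<Phi> (\<lambda>i. X i \<omega>) \<and> P (X (Suc k) \<omega>))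
    = \<P>(\<omega> in M. \<Phi> (\<lambda>i. X i \<omega>)) * \<P>(\<omega> in M. P (X (Suc k) \<omega>))"
proof -
  let ?past = "\<lambda>\<omega>. restrict (\<lambda>i. X i \<omega>) {1..k}"
  let ?next = "\<lambda>\<omega>. restrict (\<lambda>i. X i \<omega>) {Suc k}"
  let ?A = "{x \<in> {1..k} \<rightarrow>\<^sub>E S. \<Phi> x}" and ?B = "{x \<in> {Suc k} \<rightarrow>\<^sub>E S. P (x (Suc k))}"
  have X: "X i \<omega> \<in> S" if "i \<ge> 1" "\<omega> \<in> space M" for i \<omega>
    using ind that measurable_space[of "X i" M "count_space S" \<omega>] by (auto simp: indep_vars_def2)
  have "indep_var (PiM {1..k} (\<lambda>_. count_space S)) ?past (PiM {Suc k} (\<lambda>_. count_space S)) ?next"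
    by (rule indep_var_restrict[OF ind]) auto
  then have "indep_var (count_space ({1..k} \<rightarrow>\<^sub>E S)) ?past (count_space ({Suc k} \<rightarrow>\<^sub>E S)) ?next"
    by (simp only: PiM_count_space_finite_power finite_atLeastAtMost finite.intros S)
  then have prod: "prob ((\<lambda>x. (?past x, ?next x)) -` (?A \<times> ?B) \<inter> space M)
      = prob (?past -` ?A \<inter> space M) * prob (?next -` ?B \<inter> space M)"
    by (rule indep_varD) auto
  have past: "?past \<omega> \<in> ?A \<longleftrightarrow> \<Phi> (\<lambda>i. X i \<omega>)" if "\<omega> \<in> space M" for \<omega>
  proof -
    have "?past \<omega> \<in> {1..k} \<rightarrow>\<^sub>E S" using X[OF _ that] by auto
    moreover have "\<Phi> (?past \<omega>) \<longleftrightarrow> \<Phi> (\<lambda>i. X i \<omega>)" by (rule \<Phi>) simp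
    ultimately show ?thesis by auto
  qed
  have "next": "?next \<omega> \<in> ?B \<longleftrightarrow> P (X (Suc k) \<omega>)" if "\<omega> \<in> space M" for \<omega>
    using X[OF _ that] by auto
  have "(\<lambda>x. (?past x, ?next x)) -` (?A \<times> ?B) \<inter> space M
      = {\<omega> \<in> space M. \<Phi> (\<lambda>i. X i \<omega>) \<and> P (X (Suc k) \<omega>)}"
    using past "next" by blast
  moreover have "?past -` ?A \<inter> space M = {\<omega> \<in> space M. \<Phi> (\<lambda>i. X i \<omega>)}" using past by blast
  moreover have "?next -` ?B \<inter> space M = {\<omega> \<in> space M. P (X (Suc k) \<omega>)}" using "next" by blast
  ultimately show ?thesis using prod by (simp only:)
qed

end

section \<open>Records of an i.i.d. sample\<close>

locale qhat_sample = prob_space M for M :: "'a measure" +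
  fixes \<theta> :: real and l :: nat and X :: "nat \<Rightarrow> 'a \<Rightarrow> nat"
  assumes theta_pos: "\<theta> > 0" and l_ge_1: "l \<ge> 1"
    and indep: "indep_vars (\<lambda>_. count_space {l..}) X {1..}"
    and prob_eq: "\<And>j n. j \<ge> 1 \<Longrightarrow> n \<ge> l \<Longrightarrow> \<P>(\<omega> in M. X j \<omega> = n) = qhat \<theta> l n"
begin

lemma X_measurable: "j \<ge> 1 \<Longrightarrow> X j \<in> M \<rightarrow>\<^sub>M count_space {l..}"
  using indep by (auto simp: indep_vars_def2)

lemma X_ge: "j \<ge> 1 \<Longrightarrow> \<omega> \<in> space M \<Longrightarrow> l \<le> X j \<omega>"
  using measurable_space[OF X_measurable] by fastforce

lemma events_past:
  assumes "\<And>x y. (\<And>i. 1 \<le> i \<Longrightarrow> i \<le> k \<Longrightarrow> x i = y i) \<Longrightarrow> \<Phi> x \<longleftrightarrow> \<Phi> y"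
  shows "{\<omega> \<in> space M. \<Phi> (\<lambda>i. X i \<omega>)} \<in> events"
proof (rule past_event_measurable[where X = X and S = "{l..}" and k = k and \<Phi> = \<Phi>])
  show "X i \<in> M \<rightarrow>\<^sub>M count_space {l..}" if "i \<ge> 1" for i
    using that by (rule X_measurable)
  show "\<Phi> x \<longleftrightarrow> \<Phi> y" if "\<And>i. 1 \<le> i \<Longrightarrow> i \<le> k \<Longrightarrow> x i = y i" for x y
    using that by (rule assms)
qed simp

lemma prob_X_less:
  assumes "j \<ge> 1" "l \<le> m"
  shows "\<P>(\<omega> in M. X j \<omega> < m) = 1 - qhat_tail \<theta> l m"
proof -
  have ev: "{\<omega> \<in> space M. X j \<omega> = n} \<in> events" for n
    using assms(1) by (intro events_past[where k = j and \<Phi> = "\<lambda>x. x j = n"]) auto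
  have "{\<omega> \<in> space M. X j \<omega> < m} = (\<Union>n\<in>{l..<m}. {\<omega> \<in> space M. X j \<omega> = n})"
    using X_ge[OF assms(1)] by auto
  also have "prob \<dots> = (\<Sum>n=l..<m. \<P>(\<omega> in M. X j \<omega> = n))"
    using ev by (intro finite_measure_finite_Union) (auto simp: disjoint_family_on_def)
  also have "\<dots> = (\<Sum>n=l..<m. qhat \<theta> l n)"
    using assms(1) by (intro sum.cong) (auto intro: prob_eq)
  finally show ?thesis using sum_qhat_below[OF theta_pos assms(2)] by simp
qed

lemma qhat_tail_le_1: "l \<le> m \<Longrightarrow> qhat_tail \<theta> l m \<le> 1"
  using prob_X_less[OF order.refl, of m] measure_nonneg[of M "{\<omega> \<in> space M. X 1 \<omega> < m}"]
  by linarith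

text \<open>
  Each of the \<open>d\<close> terms after time \<open>k\<close> is independent of everything before it, and stays below
  \<open>m\<close> with probability \<open>1 - qhat_tail \<theta> l m\<close>.
\<close>

lemma prob_no_record_during:
  assumes m: "l \<le> m"
    and \<Phi>: "\<And>x y. (\<And>i. 1 \<le> i \<Longrightarrow> i \<le> k \<Longrightarrow> x i = y i) \<Longrightarrow> \<Phi> x \<longleftrightarrow> \<Phi> y"
  shows "\<P>(\<omega> in M. \<Phi> (\<lambda>i. X i \<omega>) \<and> (\<forall>h. k < h \<and> h \<le> k + d \<longrightarrow> X h \<omega> < m))
    = \<P>(\<omega> in M. \<Phi> (\<lambda>i. X i \<omega>)) * (1 - qhat_tail \<theta> l m) ^ d"
proof (induction d)
  case (Suc d)
  let ?\<Psi> = "\<lambda>x. \<Phi> x \<and> (\<forall>h. k < h \<and> h \<le> k + d \<longrightarrow> x h < m)"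
  have \<Psi>: "?\<Psi> x \<longleftrightarrow> ?\<Psi> y" if "\<And>i. 1 \<le> i \<Longrightarrow> i \<le> k + d \<Longrightarrow> x i = y i" for x y
    using \<Phi>[of x y] that by auto
  have "\<P>(\<omega> in M. ?\<Psi> (\<lambda>i. X i \<omega>) \<and> X (Suc (k + d)) \<omega> < m)
      = \<P>(\<omega> in M. ?\<Psi> (\<lambda>i. X i \<omega>)) * \<P>(\<omega> in M. X (Suc (k + d)) \<omega> < m)"
    by (rule prob_past_and_next[OF indep _ \<Psi>]) auto
  moreover have "{\<omega> \<in> space M. \<Phi> (\<lambda>i. X i \<omega>) \<and> (\<forall>h. k < h \<and> h \<le> k + Suc d \<longrightarrow> X h \<omega> < m)}
      = {\<omega> \<in> space M. ?\<Psi> (\<lambda>i. X i \<omega>) \<and> X (Suc (k + d)) \<omega> < m}"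
    by (auto simp: le_Suc_eq)
  ultimately show ?case
    using Suc.IH prob_X_less[of "Suc (k + d)" m] m by (simp only: power_Suc) simp
qed simp

text \<open>
  For a given level and starting time, staying below the level for \<open>d\<close> steps has geometrically
  small probability, since all tails of the kernel are positive. Countably many null sets suffice
  for all levels and times.
\<close>

lemma AE_eventually_exceeded: "AE \<omega> in M. \<forall>k m. \<exists>i>k. m \<le> X i \<omega>"
  unfolding AE_all_countable
proof (intro allI)
  fix k m
  \<comment> \<open>The closed form of the tail is valid from level \<open>l\<close> on only.\<close>
  let ?m = "max l m"
  let ?F = "1 - qhat_tail \<theta> l ?m"
  define B where "B d = {\<omega> \<in> space M. \<forall>h. k < h \<and> h \<le> k + d \<longrightarrow> X h \<omega> < ?m}" for d
  have B: "B d \<in> events" for d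
    unfolding B_def
    by (rule events_past[where k = "k + d" and \<Phi> = "\<lambda>x. \<forall>h. k < h \<and> h \<le> k + d \<longrightarrow> x h < ?m"]) auto
  have "prob (B d) = ?F ^ d" for d
    using prob_no_record_during[of ?m k "\<lambda>_. True" d] by (simp add: B_def prob_space)
  moreover have "prob (\<Inter>d. B d) \<le> prob (B d)" for d
    using B by (intro finite_measure_mono INF_lower) simp_all
  ultimately have le: "prob (\<Inter>d. B d) \<le> ?F ^ d" for d
    by simp
  have "?F \<ge> 0" "?F < 1"
    using qhat_tail_le_1[of ?m] qhat_tail_pos[OF theta_pos l_ge_1, of ?m] by simp_all
  then have "(\<lambda>d. ?F ^ d) \<longlonglongrightarrow> 0" by (rule LIMSEQ_realpow_zero)
  then have "prob (\<Inter>d. B d) \<le> 0"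
    by (rule LIMSEQ_le_const) (use le in blast)
  then have "prob (\<Inter>d. B d) = 0"
    by (simp add: measure_le_0_iff)
  moreover have ev: "(\<Inter>d. B d) \<in> events" using B by auto
  ultimately have "AE \<omega> in M. \<omega> \<notin> (\<Inter>d. B d)"
    using AE_iff_null_sets[OF ev] by (simp add: null_sets_def emeasure_eq_measure)
  then show "AE \<omega> in M. \<exists>i>k. m \<le> X i \<omega>"
  proof (rule AE_mp, intro AE_I2 impI)
    fix \<omega> assume "\<omega> \<in> space M" "\<omega> \<notin> (\<Inter>d. B d)"
    then obtain h where "k < h" "\<not> X h \<omega> < ?m" by (auto simp: B_def)
    then show "\<exists>i>k. m \<le> X i \<omega>" by (auto intro!: exI[of _ h])
  qed
qed

text \<open>
  Decompose according to the time \<open>i\<close> of the preceding record: between \<open>i\<close> and \<open>n + 1\<close> there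
  are \<open>n - i\<close> terms, all below the record \<open>s j\<close>, and then comes the value \<open>s (Suc j)\<close>.
\<close>

lemma prob_record_path_Suc:
  assumes "l \<le> s j" "s j \<le> s (Suc j)"
  shows "\<P>(\<omega> in M. record_path l s (Suc j) (Suc n) (\<lambda>i. X i \<omega>))
    = (\<Sum>i\<le>n. \<P>(\<omega> in M. record_path l s j i (\<lambda>i. X i \<omega>)) * (1 - qhat_tail \<theta> l (s j)) ^ (n - i))
      * qhat \<theta> l (s (Suc j))"
proof -
  let ?\<Psi> = "\<lambda>i x. record_path l s j i x \<and> (\<forall>h. i < h \<and> h \<le> n \<longrightarrow> x h < s j)"
  let ?E = "\<lambda>i. {\<omega> \<in> space M. ?\<Psi> i (\<lambda>i. X i \<omega>) \<and> X (Suc n) \<omega> = s (Suc j)}"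
  have \<Psi>: "?\<Psi> i x \<longleftrightarrow> ?\<Psi> i y" if "i \<le> n" "\<And>h. 1 \<le> h \<Longrightarrow> h \<le> n \<Longrightarrow> x h = y h" for i x y
  proof -
    have "record_path l s j i x \<longleftrightarrow> record_path l s j i y"
      by (rule record_path_cong) (use that in simp)
    then show ?thesis using that by auto
  qed
  have E_events: "?E i \<in> events" if "i \<le> n" for i
  proof (rule events_past[where k = "Suc n" and \<Phi> = "\<lambda>x. ?\<Psi> i x \<and> x (Suc n) = s (Suc j)"])
    fix x y :: "nat \<Rightarrow> nat"
    assume eq: "\<And>h. 1 \<le> h \<Longrightarrow> h \<le> Suc n \<Longrightarrow> x h = y h"
    have "?\<Psi> i x \<longleftrightarrow> ?\<Psi> i y" by (rule \<Psi>[OF that]) (simp add: eq)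
    moreover have "x (Suc n) = y (Suc n)" by (simp add: eq)
    ultimately show "?\<Psi> i x \<and> x (Suc n) = s (Suc j) \<longleftrightarrow> ?\<Psi> i y \<and> y (Suc n) = s (Suc j)"
      by (simp only:)
  qed
  have "prob (?E i) = \<P>(\<omega> in M. ?\<Psi> i (\<lambda>i. X i \<omega>)) * \<P>(\<omega> in M. X (Suc n) \<omega> = s (Suc j))"
    if "i \<le> n" for i
  proof (rule prob_past_and_next[OF indep, where \<Phi> = "?\<Psi> i" and P = "\<lambda>a. a = s (Suc j)"])
    show "?\<Psi> i x \<longleftrightarrow> ?\<Psi> i y" if "\<And>h. 1 \<le> h \<Longrightarrow> h \<le> n \<Longrightarrow> x h = y h" for x y
      using \<open>i \<le> n\<close> that by (rule \<Psi>)
  qed simp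
  moreover have "\<P>(\<omega> in M. ?\<Psi> i (\<lambda>i. X i \<omega>))
      = \<P>(\<omega> in M. record_path l s j i (\<lambda>i. X i \<omega>)) * (1 - qhat_tail \<theta> l (s j)) ^ (n - i)"
    if "i \<le> n" for i
  proof -
    have "\<P>(\<omega> in M. record_path l s j i (\<lambda>i. X i \<omega>)
          \<and> (\<forall>h. i < h \<and> h \<le> i + (n - i) \<longrightarrow> X h \<omega> < s j))
        = \<P>(\<omega> in M. record_path l s j i (\<lambda>i. X i \<omega>)) * (1 - qhat_tail \<theta> l (s j)) ^ (n - i)"
    proof (rule prob_no_record_during[OF assms(1)])
      show "record_path l s j i x \<longleftrightarrow> record_path l s j i y"
        if "\<And>h. 1 \<le> h \<Longrightarrow> h \<le> i \<Longrightarrow> x h = y h" for x y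
        using that by (rule record_path_cong)
    qed
    then show ?thesis using that by simp
  qed
  moreover have "\<P>(\<omega> in M. X (Suc n) \<omega> = s (Suc j)) = qhat \<theta> l (s (Suc j))"
    using assms by (intro prob_eq) auto
  ultimately have prob_E: "prob (?E i) = \<P>(\<omega> in M. record_path l s j i (\<lambda>i. X i \<omega>))
      * (1 - qhat_tail \<theta> l (s j)) ^ (n - i) * qhat \<theta> l (s (Suc j))" if "i \<le> n" for i
    using that by simp
  have union: "{\<omega> \<in> space M. record_path l s (Suc j) (Suc n) (\<lambda>i. X i \<omega>)} = (\<Union>i\<le>n. ?E i)"
    using assms(2) by (fastforce simp: less_Suc_eq_le)
  have "\<P>(\<omega> in M. record_path l s (Suc j) (Suc n) (\<lambda>i. X i \<omega>)) = (\<Sum>i\<le>n. prob (?E i))"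
    unfolding union
  proof (rule finite_measure_finite_Union)
    show "finite {..n}" by simp
    show "?E ` {..n} \<subseteq> events"
      by (rule image_subsetI) (simp only: E_events atMost_iff)
    show "disjoint_family_on ?E {..n}"
      unfolding disjoint_family_on_def
    proof (intro ballI impI equals0I)
      fix i i' \<omega> assume "i \<noteq> i'" "\<omega> \<in> ?E i \<inter> ?E i'"
      then have "record_path l s j i (\<lambda>i. X i \<omega>)" "record_path l s j i' (\<lambda>i. X i \<omega>)"
        by (simp_all only: Int_iff mem_Collect_eq)
      then have "i = i'" by (rule record_path_unique)
      with \<open>i \<noteq> i'\<close> show False ..
    qed
  qed
  also have "\<dots> = (\<Sum>i\<le>n. \<P>(\<omega> in M. record_path l s j i (\<lambda>i. X i \<omega>))
      * (1 - qhat_tail \<theta> l (s j)) ^ (n - i) * qhat \<theta> l (s (Suc j)))"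
  proof (rule sum.cong[OF refl])
    fix i assume "i \<in> {..n}"
    then have "i \<le> n" by simp
    then show "prob (?E i) = \<P>(\<omega> in M. record_path l s j i (\<lambda>i. X i \<omega>))
        * (1 - qhat_tail \<theta> l (s j)) ^ (n - i) * qhat \<theta> l (s (Suc j))"
      by (rule prob_E)
  qed
  finally show ?thesis by (simp only: sum_distrib_right)
qed

text \<open>
  Summing the convolution over the time of the new record separates it into the mass of the old
  path and a geometric series. The latter sums to \<open>1 / qhat_tail \<theta> l (s j)\<close>, which is exactly the
  factor by which the kernels started at \<open>l\<close> and at \<open>s j\<close> differ.
\<close>

lemma prob_record_path_sums:
  "(\<lambda>k. \<P>(\<omega> in M. record_path l s j k (\<lambda>i. X i \<omega>))) sums qhat_path \<theta> l s j"
proof (induction j)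
  case 0
  have "(\<lambda>k. \<P>(\<omega> in M. record_path l s 0 k (\<lambda>i. X i \<omega>))) = (\<lambda>k. if k = 0 then of_bool (s 0 = l) else 0)"
    by (auto simp: fun_eq_iff prob_space)
  then show ?case
    using sums_single[of 0 "\<lambda>_. of_bool (s 0 = l) :: real"] by (simp add: qhat_path_0)
next
  case (Suc j)
  let ?h = "\<lambda>j k. \<P>(\<omega> in M. record_path l s j k (\<lambda>i. X i \<omega>))"
  let ?T = "qhat_tail \<theta> l (s j)"
  show ?case
  proof (cases "l \<le> s j \<and> s j \<le> s (Suc j)")
    case True
    have T: "0 < ?T" using qhat_tail_pos[OF theta_pos l_ge_1] .
    then have F: "norm (1 - ?T) < 1" using qhat_tail_le_1[of "s j"] True by simp
    have "(\<lambda>n. \<Sum>i\<le>n. ?h j i * (1 - ?T) ^ (n - i)) sums ((\<Sum>k. ?h j k) * (\<Sum>d. (1 - ?T) ^ d))"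
    proof (rule Cauchy_product_sums)
      show "summable (\<lambda>k. norm (?h j k))" using Suc.IH by (simp add: sums_iff)
      show "summable (\<lambda>d. norm ((1 - ?T) ^ d))"
        using F by (simp add: power_abs summable_geometric)
    qed
    then have "(\<lambda>n. \<Sum>i\<le>n. ?h j i * (1 - ?T) ^ (n - i)) sums (qhat_path \<theta> l s j / ?T)"
      using Suc.IH suminf_geometric[OF F] by (simp add: sums_iff)
    from sums_mult2[OF this, of "qhat \<theta> l (s (Suc j))"]
    have "(\<lambda>n. ?h (Suc j) (Suc n)) sums (qhat_path \<theta> l s j / ?T * qhat \<theta> l (s (Suc j)))"
      using prob_record_path_Suc[of s j] True by simp
    \<comment> \<open>No record after the initial one can occur at time \<open>0\<close>, so the shift by one loses nothing.\<close>
    then have "?h (Suc j) sums (qhat_path \<theta> l s j / ?T * qhat \<theta> l (s (Suc j)))"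
      by (subst (asm) sums_Suc_iff) simp
    then show ?thesis
      using qhat_eq_tail_times_qhat[of l "s j" "s (Suc j)" \<theta>] True T by (simp add: qhat_path_Suc)
  next
    case False
    \<comment> \<open>Both sides vanish: a record path is nondecreasing and starts at \<open>l\<close>. If \<open>s j\<close> lies below
      \<open>l\<close>, the induction hypothesis shows that already the path up to \<open>j\<close> has weight zero.\<close>
    have "\<not> record_path l s (Suc j) k x" for k x
      using False record_path_ge[of l s j _ x] by auto
    then have "?h (Suc j) = (\<lambda>k. 0)" by (simp del: record_path.simps)
    moreover have "qhat_path \<theta> l s (Suc j) = 0"
    proof (cases "l \<le> s j")
      case True
      then show ?thesis using False by (simp add: qhat_path_Suc qhat_eq_0)
    next
      case False
      then have "\<not> record_path l s j k x" for k x using record_path_ge[of l s j k x] by blast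
      then have "?h j = (\<lambda>k. 0)" by simp
      then show ?thesis using Suc.IH sums_unique2[of "?h j" _ 0] by (simp add: qhat_path_Suc)
    qed
    ultimately show ?thesis by simp
  qed
qed

text \<open>
  An index defined by a least element is measurable, and evaluating the sequence at a random index
  preserves measurability because there are only countably many indices.
\<close>

lemma weak_record_measurable:
  "(\<lambda>\<omega>. weak_record l (\<lambda>i. X i \<omega>) j) \<in> M \<rightarrow>\<^sub>M count_space UNIV"
proof -
  define Y where "Y = (\<lambda>i. X (max 1 i))"
  have Y[measurable]: "Y i \<in> M \<rightarrow>\<^sub>M count_space UNIV" for i
    unfolding Y_def by (rule measurable_count_space_UNIV, rule X_measurable) simp
  have index: "(\<lambda>\<omega>. weak_record_index (\<lambda>i. Y i \<omega>) j) \<in> M \<rightarrow>\<^sub>M count_space UNIV" for j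
  proof (induction j)
    case (Suc j)
    note IH = Suc.IH
    have le: "Measurable.pred M (\<lambda>\<omega>. Y k \<omega> \<le> Y i \<omega>)" for i k
    proof (rule measurable_compose_countable[where f = "\<lambda>a \<omega>. a \<le> Y i \<omega>", OF _ Y])
      show "Measurable.pred M (\<lambda>\<omega>. a \<le> Y i \<omega>)" for a
        by (rule measurable_compose[OF Y[of i], where g = "\<lambda>n. a \<le> n"]) simp
    qed
    note le[measurable]
    have next_index: "(\<lambda>\<omega>. if \<exists>i>k. Y i \<omega> \<ge> Y k \<omega> then LEAST i. i > k \<and> Y i \<omega> \<ge> Y k \<omega> else k)
        \<in> M \<rightarrow>\<^sub>M count_space UNIV" for k
      by measurable
    show ?case
    proof (cases j)
      case (Suc j')
      show ?thesis
        unfolding Suc weak_record_index.simps Let_def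
        using measurable_compose_countable[OF next_index IH] unfolding Suc .
    qed simp
  qed simp
  have "(\<lambda>\<omega>. Y (weak_record_index (\<lambda>i. Y i \<omega>) j) \<omega>) \<in> M \<rightarrow>\<^sub>M count_space UNIV"
    by (rule measurable_compose_countable[OF Y index])
  then have "(\<lambda>\<omega>. weak_record l (\<lambda>i. Y i \<omega>) j) \<in> M \<rightarrow>\<^sub>M count_space UNIV"
    by (cases "j = 0") (simp_all add: weak_record_def)
  then show ?thesis
    unfolding Y_def weak_record_max_1[where x = "\<lambda>i. X i \<omega>" for \<omega>] .
qed

text \<open>
  Almost surely, the records follow \<open>s\<close> up to \<open>j\<close> for exactly one time \<open>k\<close> of the \<open>j\<close>-th record,
  so the probabilities over all \<open>k\<close> add up.
\<close>

lemma prob_weak_record: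
  "\<P>(\<omega> in M. \<forall>i\<le>j. weak_record l (\<lambda>i. X i \<omega>) i = s i) = qhat_path \<theta> l s j"
proof -
  note weak_record_measurable[measurable]
  have "(\<lambda>k. \<P>(\<omega> in M. record_path l s j k (\<lambda>i. X i \<omega>)))
      sums \<P>(\<omega> in M. \<forall>i\<le>j. weak_record l (\<lambda>i. X i \<omega>) i = s i)"
  proof (rule prob_sums)
    show "{\<omega> \<in> space M. record_path l s j k (\<lambda>i. X i \<omega>)} \<in> events" for k
    proof (rule events_past[where k = k])
      show "record_path l s j k x \<longleftrightarrow> record_path l s j k y"
        if "\<And>h. 1 \<le> h \<Longrightarrow> h \<le> k \<Longrightarrow> x h = y h" for x y
        using that by (rule record_path_cong)
    qed
    show "{\<omega> \<in> space M. \<forall>i\<le>j. weak_record l (\<lambda>i. X i \<omega>) i = s i} \<in> events"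
      by measurable
    show "AE \<omega> in M. (\<forall>k. record_path l s j k (\<lambda>i. X i \<omega>)
          \<longrightarrow> (\<forall>i\<le>j. weak_record l (\<lambda>i. X i \<omega>) i = s i))
        \<and> ((\<forall>i\<le>j. weak_record l (\<lambda>i. X i \<omega>) i = s i)
          \<longrightarrow> (\<exists>!k. record_path l s j k (\<lambda>i. X i \<omega>)))"
      using AE_eventually_exceeded
    proof (rule AE_mp, intro AE_I2 impI)
      fix \<omega> assume \<omega>: "\<omega> \<in> space M" "\<forall>k m. \<exists>i>k. m \<le> X i \<omega>"
      have iff: "record_path l s j k (\<lambda>i. X i \<omega>) \<longleftrightarrow> k = weak_record_index (\<lambda>i. X i \<omega>) j
          \<and> (\<forall>i\<le>j. weak_record l (\<lambda>i. X i \<omega>) i = s i)" for k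
      proof (rule record_path_iff)
        show "l \<le> X i \<omega>" if "i \<ge> 1" for i using that \<omega>(1) by (rule X_ge)
        show "\<exists>i>k. m \<le> X i \<omega>" for k m using \<omega>(2) by blast
      qed
      then show "(\<forall>k. record_path l s j k (\<lambda>i. X i \<omega>)
            \<longrightarrow> (\<forall>i\<le>j. weak_record l (\<lambda>i. X i \<omega>) i = s i))
          \<and> ((\<forall>i\<le>j. weak_record l (\<lambda>i. X i \<omega>) i = s i)
            \<longrightarrow> (\<exists>!k. record_path l s j k (\<lambda>i. X i \<omega>)))"
      proof (intro conjI allI impI)
        show "weak_record l (\<lambda>i. X i \<omega>) i = s i" if "record_path l s j k (\<lambda>i. X i \<omega>)" "i \<le> j" for k i
          using that iff by blast
        assume "\<forall>i\<le>j. weak_record l (\<lambda>i. X i \<omega>) i = s i"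
        then show "\<exists>!k. record_path l s j k (\<lambda>i. X i \<omega>)"
          unfolding iff by blast
      qed
    qed
  qed
  then show ?thesis using prob_record_path_sums by (rule sums_unique2)
qed

end

section \<open>Finite-dimensional distributions\<close>

lemma markov_chain_measurable:
  "markov_chain N S s0 p Q \<Longrightarrow> Q j \<in> N \<rightarrow>\<^sub>M count_space UNIV"
  unfolding markov_chain_def by (blast intro: measurable_count_space_UNIV)

lemma markov_chain_cond_prob:
  assumes "markov_chain M S s0 p Y" "n \<in> S" "\<P>(\<omega> in M. \<forall>i\<le>j. Y i \<omega> = s i) > 0"
  shows "\<P>(\<omega> in M. Y (Suc j) \<omega> = n \<bar> \<forall>i\<le>j. Y i \<omega> = s i) = p (s j) n"
  using assms unfolding markov_chain_def by blast

text \<open>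
  The chain rule for conditional probabilities. Conditioning says nothing after a history of
  probability zero, nor about a target outside the state space; there the product vanishes as
  well, in the second case because the only such target, \<open>0\<close>, lies below every state.
\<close>

lemma prob_qhat_chain:
  assumes mc: "markov_chain N {1..} l (qhat \<theta>) Q"
  shows "\<P>(\<omega> in N. \<forall>i\<le>j. Q i \<omega> = s i) = qhat_path \<theta> l s j"
proof -
  interpret prob_space N using mc by (simp add: markov_chain_def)
  note [measurable] = markov_chain_measurable[OF mc]
  have Q_ge: "1 \<le> Q i \<omega>" if "\<omega> \<in> space N" for i \<omega>
    using mc measurable_space[of "Q i" N "count_space {1..}" \<omega>] that
    by (auto simp: markov_chain_def)
  show ?thesis
  proof (induction j)
    case 0
    have "\<P>(\<omega> in N. Q 0 \<omega> = s 0) = \<P>(\<omega> in N. l = s 0)"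
      using mc by (intro prob_eq_AE) (auto simp: markov_chain_def elim: AE_mp)
    then show ?case by (auto simp: qhat_path_0 prob_space)
  next
    case (Suc j)
    let ?H = "\<lambda>j. \<P>(\<omega> in N. \<forall>i\<le>j. Q i \<omega> = s i)"
    have mono: "?H (Suc j) \<le> ?H j"
      by (intro finite_measure_mono) auto
    show ?case
    proof (cases "?H j > 0")
      case False
      then have "?H j = 0" by (simp add: zero_less_measure_iff)
      then have "?H (Suc j) = 0" using mono by (simp add: measure_le_0_iff)
      then show ?thesis using Suc.IH \<open>?H j = 0\<close> by (simp add: qhat_path_Suc)
    next
      case True
      then have "{\<omega> \<in> space N. \<forall>i\<le>j. Q i \<omega> = s i} \<noteq> {}"
        by (intro notI) (simp only: measure_empty less_irrefl)
      then obtain \<omega> where "\<omega> \<in> space N" "\<forall>i\<le>j. Q i \<omega> = s i"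
        by blast
      then have sj: "1 \<le> s j" using Q_ge[of \<omega> j] by simp
      show ?thesis
      proof (cases "1 \<le> s (Suc j)")
        case s: True
        have "\<P>(\<omega> in N. Q (Suc j) \<omega> = s (Suc j) \<bar> \<forall>i\<le>j. Q i \<omega> = s i) = qhat \<theta> (s j) (s (Suc j))"
          by (rule markov_chain_cond_prob[OF mc]) (use True s in simp_all)
        moreover have "\<P>(\<omega> in N. Q (Suc j) \<omega> = s (Suc j) \<bar> \<forall>i\<le>j. Q i \<omega> = s i) = ?H (Suc j) / ?H j"
          unfolding cond_prob_def
          by (rule arg_cong[where f = "\<lambda>A. measure N A / _"]) (auto simp: le_Suc_eq)
        ultimately show ?thesis using True Suc.IH by (simp add: qhat_path_Suc field_simps)
      next
        case False
        have "Q (Suc j) \<omega> \<noteq> s (Suc j)" if "\<omega> \<in> space N" for \<omega>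
          using Q_ge[OF that, of "Suc j"] False by linarith
        then have "{\<omega> \<in> space N. \<forall>i\<le>Suc j. Q i \<omega> = s i} = {}" by auto
        then have "?H (Suc j) = 0" by (simp only: measure_empty)
        moreover have "qhat \<theta> (s j) (s (Suc j)) = 0" using sj False by (intro qhat_eq_0) simp
        ultimately show ?thesis by (simp add: qhat_path_Suc)
      qed
    qed
  qed
qed

text \<open>
  A sequence of discrete random variables takes its first \<open>n + 1\<close> values in a countable space, so
  the probabilities of initial segments determine their joint law. Every finite set of coordinates
  is covered by such a segment, and the corresponding cylinders generate the product sigma-algebra.
\<close>

lemma distr_sequence_eqI:
  fixes Y :: "nat \<Rightarrow> 'a \<Rightarrow> 'c :: countable" and Z :: "nat \<Rightarrow> 'b \<Rightarrow> 'c"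
  assumes M: "prob_space M" and N: "prob_space N"
    and Y[measurable]: "\<And>j. Y j \<in> M \<rightarrow>\<^sub>M count_space UNIV"
    and Z[measurable]: "\<And>j. Z j \<in> N \<rightarrow>\<^sub>M count_space UNIV"
    and eq: "\<And>j s. \<P>(\<omega> in M. \<forall>i\<le>j. Y i \<omega> = s i) = \<P>(\<omega> in N. \<forall>i\<le>j. Z i \<omega> = s i)"
  shows "distr M (PiM UNIV (\<lambda>_. count_space UNIV)) (\<lambda>\<omega> j. Y j \<omega>)
       = distr N (PiM UNIV (\<lambda>_. count_space UNIV)) (\<lambda>\<omega> j. Z j \<omega>)" (is "?P = ?Q")
proof (rule measure_eqI_PiM_infinite)
  let ?Pi = "PiM UNIV (\<lambda>_. count_space UNIV) :: (nat \<Rightarrow> 'c) measure"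
  interpret M: prob_space M by fact
  interpret N: prob_space N by fact
  have MY: "(\<lambda>\<omega> j. Y j \<omega>) \<in> M \<rightarrow>\<^sub>M ?Pi" and NZ: "(\<lambda>\<omega> j. Z j \<omega>) \<in> N \<rightarrow>\<^sub>M ?Pi"
    by (rule measurable_PiM_single'; simp)+
  show "finite_measure ?P"
    using M.prob_space_distr[OF MY] by (rule prob_space.finite_measure)
  show "sets ?P = sets ?Pi" "sets ?Q = sets ?Pi" by simp_all
  fix A J assume J: "finite J" "J \<subseteq> (UNIV :: nat set)"
    and A: "\<And>i. i \<in> J \<Longrightarrow> A i \<in> sets (count_space (UNIV :: 'c set))"
  obtain n where n: "J \<subseteq> {..n}" using J(1) finite_nat_iff_bounded_le by blast
  define C where "C = ({..n} \<rightarrow>\<^sub>E (UNIV :: 'c set))"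
  have C: "countable C" unfolding C_def by (rule countable_PiE) auto
  define YC where "YC = (\<lambda>\<omega>. restrict (\<lambda>i. Y i \<omega>) {..n})"
  define ZC where "ZC = (\<lambda>\<omega>. restrict (\<lambda>i. Z i \<omega>) {..n})"
  have "YC \<in> M \<rightarrow>\<^sub>M PiM {..n} (\<lambda>_. count_space UNIV)" "ZC \<in> N \<rightarrow>\<^sub>M PiM {..n} (\<lambda>_. count_space UNIV)"
    unfolding YC_def ZC_def by (intro measurable_restrict; simp)+
  then have YC: "YC \<in> M \<rightarrow>\<^sub>M count_space C" and ZC: "ZC \<in> N \<rightarrow>\<^sub>M count_space C"
    unfolding C_def PiM_count_space_finite_power[OF finite_atMost countableI_type] .
  have marginals: "distr M (count_space C) YC = distr N (count_space C) ZC"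
  proof (rule measure_eqI_countable[OF _ _ C])
    fix s assume s: "s \<in> C"
    have "restrict f {..n} = s \<longleftrightarrow> (\<forall>i\<le>n. f i = s i)" for f
      using s unfolding C_def by (auto simp: fun_eq_iff PiE_def extensional_def)
    then have "YC -` {s} \<inter> space M = {\<omega> \<in> space M. \<forall>i\<le>n. Y i \<omega> = s i}"
      "ZC -` {s} \<inter> space N = {\<omega> \<in> space N. \<forall>i\<le>n. Z i \<omega> = s i}"
      unfolding YC_def ZC_def by auto
    then show "emeasure (distr M (count_space C) YC) {s} = emeasure (distr N (count_space C) ZC) {s}"
      using s YC ZC eq by (simp add: emeasure_distr M.emeasure_eq_measure N.emeasure_eq_measure)
  qed simp_all
  let ?E = "prod_emb UNIV (\<lambda>_. count_space UNIV) J (Pi\<^sub>E J A)"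
  let ?D = "{s \<in> C. \<forall>i\<in>J. s i \<in> A i}"
  have E: "?E \<in> sets ?Pi" using J A by (intro sets_PiM_I) auto
  have mem_E: "x \<in> ?E \<longleftrightarrow> (\<forall>i\<in>J. x i \<in> A i)" for x
    by (auto simp: prod_emb_def)
  have "(\<lambda>\<omega> j. Y j \<omega>) -` ?E \<inter> space M = YC -` ?D \<inter> space M"
    "(\<lambda>\<omega> j. Z j \<omega>) -` ?E \<inter> space N = ZC -` ?D \<inter> space N"
    using n unfolding YC_def ZC_def C_def by (auto simp: mem_E subset_iff)
  moreover have "emeasure (distr M (count_space C) YC) ?D = emeasure (distr N (count_space C) ZC) ?D"
    using marginals by simp
  ultimately show "emeasure ?P ?E = emeasure ?Q ?E"
    using MY NZ E YC ZC by (simp add: emeasure_distr)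
qed

theorem proposition2p2:
  fixes \<theta> :: real and l :: nat
    and N :: "'b measure" and Q :: "nat \<Rightarrow> 'b \<Rightarrow> nat"
    and M :: "'a measure" and X :: "nat \<Rightarrow> 'a \<Rightarrow> nat"
  assumes "\<theta> > 0" and "l \<ge> 1"
    and "markov_chain N {1..} l (qhat \<theta>) Q"
    and "prob_space M"
    and "prob_space.indep_vars M (\<lambda>_. count_space {l..}) X {1..}"
    and "\<And>j n. j \<ge> 1 \<Longrightarrow> n \<ge> l \<Longrightarrow> \<P>(\<omega> in M. X j \<omega> = n) = qhat \<theta> l n"
  shows "distr N (PiM UNIV (\<lambda>_. count_space UNIV)) (\<lambda>\<omega> j. Q j \<omega>) =
         distr M (PiM UNIV (\<lambda>_. count_space UNIV))
           (\<lambda>\<omega> j. weak_record l (\<lambda>i. X i \<omega>) j)"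
proof (rule distr_sequence_eqI)
  interpret prob_space M by fact
  interpret qhat_sample M \<theta> l X
    using assms by unfold_locales auto
  show "prob_space N" using assms(3) by (simp add: markov_chain_def)
  show "prob_space M" by fact
  show "Q j \<in> N \<rightarrow>\<^sub>M count_space UNIV" for j
    using assms(3) by (rule markov_chain_measurable)
  show "(\<lambda>\<omega>. weak_record l (\<lambda>i. X i \<omega>) j) \<in> M \<rightarrow>\<^sub>M count_space UNIV" for j
    by (rule weak_record_measurable)
  show "\<P>(\<omega> in N. \<forall>i\<le>j. Q i \<omega> = s i)
      = \<P>(\<omega> in M. \<forall>i\<le>j. weak_record l (\<lambda>i. X i \<omega>) i = s i)" for j s
    by (simp add: prob_qhat_chain[OF assms(3)] prob_weak_record)
qed

end
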